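(* Let $1<p\le\infty$ and let $q$ be given by $1/p+1/q=1$. For any $s>1/q$ there is a constant $C(q,s)$ depending only on $s$ and $q$ such that $$E_n(\mathcal{U}_{\rho^*(s),p})\le\delta_{n,q}(\rho^*(s))\le C(q,s)\,n^{-s+1/q}\,n^{\frac{4s\sqrt{4+\log_2 n}}{\log_2 n}},\qquad n\ge2.$$
   Context: $X$ is a Banach space, $\mathbb{N}_0=\{0,1,2,\dots\}$, $Y=[-1,1]^{\mathbb{N}}$. $\mathcal{F}$ is the set of all sequences $\nu=(\nu_1,\nu_2,\dots)$ with entries in $\mathbb{N}_0$ and only finitely many nonzero entries; $y^\nu=\prod_jy_j^{\nu_j}$, $\rho^\nu=\prod_j\rho_j^{\nu_j}$, $\rho^{-\nu}=1/\rho^\nu$. $L_\infty(Y,X)$ is the space of bounded maps $v:Y\to X$ with the sup norm. Let $I_1=\{1,2\}$ and $I_k=\{j\in\mathbb{N}:2^{k-1}<j\le2^k\}$ for $k\ge2$. For $s>0$, $\rho^*(s)$ is the sequence with $\rho^*_j(s)=2^{ks}$ for $j\in I_k$, $k\ge1$. For a nondecreasing sequence $\rho$ with $\rho_1>1$, $\rho_j\to\infty$, $(\delta_n(\rho))_{n\ge1}$ is the decreasing rearrangement (with repetitions) of $(\rho^{-\nu})_{\nu\in\mathcal{F}}$, and for $0<q<\infty$, $\delta_{n,q}(\rho)=\big(\sum_{j>n}\delta_j(\rho)^q\big)^{1/q}$. $\mathcal{B}_{\rho,p}$ ($0<p\le\infty$) is the set of $u\in L_\infty(Y,X)$ which admit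 a representation $u(y)=\sum_{\nu\in\mathcal{F}}t_\nu y^\nu$, $y\in Y$, with unique $t_\nu\in X$, where the series converges uniformly unconditionally on $Y$ (any rearrangement converges in $X$ to $u$, uniformly on $Y$), and $\|u\|_{\mathcal{B}_{\rho,p}}:=\|(\rho^\nu\|t_\nu\|_X)_{\nu\in\mathcal{F}}\|_{\ell_p(\mathcal{F})}<\infty$. $\mathcal{U}_{\rho,p}=\{u:\|u\|_{\mathcal{B}_{\rho,p}}\le1\}$. A set $\Lambda\subset\mathcal{F}$ is a lower set if $\nu\in\Lambda$ and $\mu\in\mathcal{F}$, $\mu_j\le\nu_j$ for all $j$, imply $\mu\in\Lambda$. $\mathcal{L}_n$ is the collection of lower sets with $\#\Lambda\le n$; $\mathcal{P}_\Lambda=\{\sum_{\nu\in\Lambda}c_\nu y^\nu:c_\nu\in X\}$; and $E_n(K)=\inf_{\Lambda\in\mathcal{L}_n}\sup_{u\in K}\inf_{P\in\mathcal{P}_\Lambda}\|u-P\|_{L_\infty(Y,X)}$. *)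

theory Defs
  imports "HOL-Analysis.Analysis"
begin

text \<open>
  Sequences indexed by the positive integers are modelled as functions on \<open>nat\<close> with a
  shift by one: \<open>y j\<close> is the entry written $y_{j+1}$ in the mathematical text
  (likewise for \<open>\<rho>\<close> and \<open>\<nu>\<close>).  The rearrangement \<open>\<delta>\<close>, in contrast, is indexed from 1.
  A map on the parameter domain is a total function of which only the values on \<open>Y_dom\<close> matter.
\<close>

definition Y_dom :: "(nat \<Rightarrow> real) set" where
  "Y_dom = {y. \<forall>j. y j \<in> {-1..1}}"

definition multi_indices :: "(nat \<Rightarrow> nat) set" where
  "multi_indices = {\<nu>. finite {j. \<nu> j \<noteq> 0}}"

definition mpow :: "(nat \<Rightarrow> real) \<Rightarrow> (nat \<Rightarrow> nat) \<Rightarrow> real" where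
  "mpow y \<nu> = (\<Prod>j | \<nu> j \<noteq> 0. y j ^ \<nu> j)"

definition block :: "nat \<Rightarrow> nat set" where
  "block k = (if k = 1 then {1, 2} else {2 ^ (k - 1)<..2 ^ k})"

text \<open>The blocks of positive integers partition \<open>{1..}\<close>, so the block number is well defined.\<close>

definition rho_star :: "real \<Rightarrow> nat \<Rightarrow> real" where
  "rho_star s j = 2 powr (real (THE k. 1 \<le> k \<and> Suc j \<in> block k) * s)"

text \<open>The (quasi-)norm of a real family in \<open>\<ell>\<^sub>p(A)\<close> for \<open>0 < p \<le> \<infinity>\<close>, equal to \<open>\<infinity>\<close> for families
  outside that space.\<close>

definition lp_norm :: "ennreal \<Rightarrow> 'i set \<Rightarrow> ('i \<Rightarrow> real) \<Rightarrow> ennreal" where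
  "lp_norm p A f =
     (if p = \<infinity> then (SUP i\<in>A. ennreal \<bar>f i\<bar>)
      else if (\<lambda>i. \<bar>f i\<bar> powr enn2real p) summable_on A
        then ennreal ((\<Sum>\<^sub>\<infinity>i\<in>A. \<bar>f i\<bar> powr enn2real p) powr (1 / enn2real p))
      else \<infinity>)"

text \<open>The sequence is determined by this condition at all positions \<open>j \<ge> 1\<close>;
  the value at \<open>0\<close> is never used.  It exists if \<open>\<rho>\<close> is nondecreasing and tends to infinity
  with all entries greater than 1.\<close>

definition decr_rearr :: "(nat \<Rightarrow> real) \<Rightarrow> nat \<Rightarrow> real" where
  "decr_rearr \<rho> = (SOME d. \<exists>\<pi>. bij_betw \<pi> {1..} multi_indices
      \<and> (\<forall>j\<ge>1. d j = 1 / mpow \<rho> (\<pi> j))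
      \<and> (\<forall>i\<ge>1. \<forall>j\<ge>i. d j \<le> d i))"

definition delta_tail :: "(nat \<Rightarrow> real) \<Rightarrow> nat \<Rightarrow> real \<Rightarrow> ennreal" where
  "delta_tail \<rho> n q = lp_norm (ennreal q) {n<..} (decr_rearr \<rho>)"

definition Linf_norm :: "((nat \<Rightarrow> real) \<Rightarrow> 'a::real_normed_vector) \<Rightarrow> ennreal" where
  "Linf_norm v = (SUP y\<in>Y_dom. ennreal (norm (v y)))"

text \<open>Uniform unconditional convergence: every enumeration of the multi-indices gives a series
  that converges to \<open>u\<close> uniformly on the domain.  Coefficient families are \<open>undefined\<close> outside
  the multi-indices, so that uniqueness can be expressed as uniqueness of a function.\<close>

definition power_series_rep ::
  "((nat \<Rightarrow> real) \<Rightarrow> 'a::real_normed_vector) \<Rightarrow> ((nat \<Rightarrow> nat) \<Rightarrow> 'a) \<Rightarrow> bool" where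
  "power_series_rep u t \<longleftrightarrow> t \<in> extensional multi_indices
     \<and> (\<forall>\<pi>. bij_betw \<pi> (UNIV :: nat set) multi_indices \<longrightarrow>
           uniform_limit Y_dom (\<lambda>m y. \<Sum>i<m. mpow y (\<pi> i) *\<^sub>R t (\<pi> i)) u sequentially)"

definition B_norm ::
  "(nat \<Rightarrow> real) \<Rightarrow> ennreal \<Rightarrow> ((nat \<Rightarrow> real) \<Rightarrow> 'a::real_normed_vector) \<Rightarrow> ennreal" where
  "B_norm \<rho> p u =
     lp_norm p multi_indices (\<lambda>\<nu>. mpow \<rho> \<nu> * norm ((THE t. power_series_rep u t) \<nu>))"

definition B_space ::
  "(nat \<Rightarrow> real) \<Rightarrow> ennreal \<Rightarrow> ((nat \<Rightarrow> real) \<Rightarrow> 'a::real_normed_vector) set" where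
  "B_space \<rho> p = {u. bounded (u ` Y_dom) \<and> (\<exists>!t. power_series_rep u t) \<and> B_norm \<rho> p u < \<infinity>}"

definition U_ball ::
  "(nat \<Rightarrow> real) \<Rightarrow> ennreal \<Rightarrow> ((nat \<Rightarrow> real) \<Rightarrow> 'a::real_normed_vector) set" where
  "U_ball \<rho> p = {u \<in> B_space \<rho> p. B_norm \<rho> p u \<le> 1}"

definition lower_set :: "(nat \<Rightarrow> nat) set \<Rightarrow> bool" where
  "lower_set \<Lambda> \<longleftrightarrow> \<Lambda> \<subseteq> multi_indices
     \<and> (\<forall>\<nu>\<in>\<Lambda>. \<forall>\<mu>\<in>multi_indices. (\<forall>j. \<mu> j \<le> \<nu> j) \<longrightarrow> \<mu> \<in> \<Lambda>)"

definition lower_sets :: "nat \<Rightarrow> (nat \<Rightarrow> nat) set set" where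
  "lower_sets n = {\<Lambda>. lower_set \<Lambda> \<and> finite \<Lambda> \<and> card \<Lambda> \<le> n}"

definition poly_space ::
  "(nat \<Rightarrow> nat) set \<Rightarrow> ((nat \<Rightarrow> real) \<Rightarrow> 'a::real_normed_vector) set" where
  "poly_space \<Lambda> = {\<lambda>y. \<Sum>\<nu>\<in>\<Lambda>. mpow y \<nu> *\<^sub>R c \<nu> | c. True}"

definition approx_error ::
  "nat \<Rightarrow> ((nat \<Rightarrow> real) \<Rightarrow> 'a::real_normed_vector) set \<Rightarrow> ennreal" where
  "approx_error n K =
     (INF \<Lambda>\<in>lower_sets n. SUP u\<in>K. INF P\<in>poly_space \<Lambda>. Linf_norm (\<lambda>y. u y - P y))"

end

theory Submission
  imports Defs
begin

text \<open>
  Enumerate the multi-indices so that \<open>\<rho>\<^sup>-\<^sup>\<nu>\<close> decreases.  Since all \<open>\<rho>\<^sub>j > 1\<close>, a multi-index strictly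
  below \<open>\<nu>\<close> precedes \<open>\<nu>\<close> even in the presence of ties, so the first \<open>n\<close> multi-indices form a lower
  set; truncating the power series there leaves an error that Hoelder's inequality bounds by
  \<open>\<delta>\<^sub>n\<^sub>,\<^sub>q\<close>.

  For the rate, take \<open>\<beta> = (1 + h) / s\<close>.  The Euler product
  \<open>S = \<Sum>\<^sub>\<nu> \<rho>\<^sup>-\<^sup>\<beta>\<^sup>\<nu> = \<Prod>\<^sub>j 1 / (1 - \<rho>\<^sub>j\<^sup>-\<^sup>\<beta>)\<close> is at most \<open>2 powr (1 + 2 / h)\<close>, because the blocks contribute a
  geometric series of ratio \<open>2 powr (- h)\<close>.  Stechkin's inequality turns this into
  \<open>\<delta>\<^sub>n\<^sub>,\<^sub>q \<le> n powr (1 / q - 1 / \<beta>) * S powr (1 / \<beta>)\<close>, and \<open>h = 1 / sqrt (4 + log 2 n)\<close> balances the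
  loss in the exponent of \<open>n\<close> against the growth of \<open>S\<close>.  The requirement \<open>\<beta> \<le> q\<close> fails for finitely
  many \<open>n\<close> only, which the constant absorbs.
\<close>

section \<open>Monomials and monotonicity of weights\<close>

text \<open>Brings multi-indices with different supports to one common index set, where their
  monomials can be compared factor by factor.\<close>

lemma mpow_eq_prod:
  assumes "finite S" "{j. \<nu> j \<noteq> 0} \<subseteq> S"
  shows "mpow y \<nu> = (\<Prod>j\<in>S. y j ^ \<nu> j)"
  unfolding mpow_def by (rule prod.mono_neutral_left) (use assms in auto)

lemma mpow_pos: "(\<And>j. 0 < y j) \<Longrightarrow> 0 < mpow y \<nu>"
  unfolding mpow_def by (intro prod_pos) simp

lemma mpow_powr:
  assumes "\<And>j. 0 < y j"
  shows "mpow (\<lambda>j. y j powr a) \<nu> = mpow y \<nu> powr a"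
proof -
  have "(y j powr a) ^ k = (y j ^ k) powr a" for j k
    using assms[of j] by (simp add: powr_realpow[symmetric] powr_powr mult.commute)
  then show ?thesis
    unfolding mpow_def by (simp add: prod_powr_distrib assms less_imp_le)
qed

lemma abs_mpow_le_1:
  assumes "y \<in> Y_dom"
  shows "\<bar>mpow y \<nu>\<bar> \<le> 1"
proof -
  have "\<bar>y j\<bar> \<le> 1" for j
    using assms by (auto simp: Y_dom_def abs_le_iff dest: spec[of _ j])
  then show ?thesis
    unfolding mpow_def abs_prod by (intro prod_le_1) (auto simp: power_abs power_le_one)
qed

text \<open>Some coordinate drops strictly and its factor drops with it because the base exceeds 1,
  while no other factor grows. The strictness is what later settles ties in the ordering of the
  multi-indices.\<close>

lemma mpow_strict_mono:
  assumes y: "\<And>j. 1 < y j" and \<nu>: "\<nu> \<in> multi_indices"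
    and le: "\<And>j. \<mu> j \<le> \<nu> j" and neq: "\<mu> \<noteq> \<nu>"
  shows "mpow y \<mu> < mpow y \<nu>"
proof -
  define S where "S = {j. \<nu> j \<noteq> 0}"
  have fin: "finite S" using \<nu> by (simp add: S_def multi_indices_def)
  have sub: "{j. \<mu> j \<noteq> 0} \<subseteq> S"
    unfolding S_def using le by (metis (mono_tags) Collect_mono le_zero_eq)
  obtain i where "\<mu> i \<noteq> \<nu> i" using neq by auto
  with le[of i] have i: "\<mu> i < \<nu> i" by simp
  then have "i \<in> S" by (simp add: S_def)
  have "(\<Prod>j\<in>S. y j ^ \<mu> j) < (\<Prod>j\<in>S. y j ^ \<nu> j)"
  proof (rule prod_mono_strict[OF \<open>i \<in> S\<close> _ fin])
    show "y i ^ \<mu> i < y i ^ \<nu> i" using i y[of i] by simp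
    show "0 < y j ^ \<nu> j" for j using y[of j] by simp
    show "0 \<le> y j ^ \<mu> j \<and> y j ^ \<mu> j \<le> y j ^ \<nu> j" for j
      using y[of j] le[of j] by (simp add: power_increasing)
  qed
  then show ?thesis
    by (simp add: mpow_eq_prod[OF fin sub] mpow_eq_prod[OF fin, of \<nu>] S_def)
qed

section \<open>Euler product bound for sums of monomials\<close>

text \<open>By convexity of \<open>exp\<close>, the function \<open>2 powr (- 2 * x)\<close> lies
  below its chord over the interval from 0 to 1/2, and this chord is \<open>1 - x\<close>.\<close>

lemma inverse_one_minus_le:
  fixes x :: real
  assumes "0 \<le> x" "x \<le> 1/2"
  shows "1 / (1 - x) \<le> 2 powr (2 * x)"
proof -
  have "2 powr (- (2 * x)) = exp ((1 - 2*x) *\<^sub>R 0 + (2*x) *\<^sub>R (- ln 2))"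
    by (simp add: powr_def)
  also have "\<dots> \<le> (1 - 2*x) * exp 0 + (2*x) * exp (- ln (2::real))"
    by (rule convex_onD[OF exp_convex]) (use assms in auto)
  also have "\<dots> = 1 - x" by (simp add: exp_minus)
  finally have "1 / (1 - x) \<le> 1 / 2 powr (- (2 * x))"
    by (intro divide_left_mono) (use assms in auto)
  then show ?thesis by (simp add: powr_minus divide_simps)
qed

text \<open>A finite \<open>F\<close> fits into a box: supports below \<open>J\<close>, entries
  below \<open>M\<close>. The sum over the box factors into truncated geometric series, and the
  resulting bound depends on neither \<open>J\<close> nor \<open>M\<close>.\<close>

lemma sum_mpow_le:
  assumes x0: "\<And>j. 0 \<le> x j" and xh: "\<And>j. x j \<le> 1/2"
    and B: "\<And>J. (\<Sum>j<J. x j) \<le> B"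
    and F: "finite F" "F \<subseteq> multi_indices"
  shows "(\<Sum>\<nu>\<in>F. mpow x \<nu>) \<le> 2 powr (2 * B)"
proof -
  have "finite (\<Union>\<nu>\<in>F. {j. \<nu> j \<noteq> 0})"
    using F by (auto simp: multi_indices_def)
  then obtain J where J: "(\<Union>\<nu>\<in>F. {j. \<nu> j \<noteq> 0}) \<subseteq> {..<J}"
    using finite_nat_bounded by blast
  have supp: "{j. \<nu> j \<noteq> 0} \<subseteq> {..<J}" if "\<nu> \<in> F" for \<nu>
    using J that by blast
  have "finite (\<Union>\<nu>\<in>F. \<nu> ` {..<J})" using F by auto
  then obtain M where M: "(\<Union>\<nu>\<in>F. \<nu> ` {..<J}) \<subseteq> {..<M}"
    using finite_nat_bounded by blast
  \<comment> \<open>Members of \<open>Pi\<^sub>E\<close> are \<open>undefined\<close> off the index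
    set whereas multi-indices vanish there, so \<open>F\<close> is moved into the box by
    restriction.\<close>
  have inj: "inj_on (\<lambda>\<nu>. restrict \<nu> {..<J}) F"
  proof (rule inj_onI)
    fix \<nu> \<mu> assume *: "\<nu> \<in> F" "\<mu> \<in> F" "restrict \<nu> {..<J} = restrict \<mu> {..<J}"
    show "\<nu> = \<mu>"
    proof
      fix j
      show "\<nu> j = \<mu> j"
      proof (cases "j < J")
        case True
        then show ?thesis using fun_cong[OF *(3), of j] by simp
      next
        case False
        then show ?thesis using supp[OF *(1)] supp[OF *(2)]
          by (metis (mono_tags) lessThan_iff mem_Collect_eq subsetD)
      qed
    qed
  qed
  have "(\<Sum>\<nu>\<in>F. mpow x \<nu>) = (\<Sum>\<nu>\<in>F. \<Prod>j<J. x j ^ restrict \<nu> {..<J} j)"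
    by (intro sum.cong refl) (simp add: mpow_eq_prod[OF _ supp])
  also have "\<dots> = (\<Sum>g\<in>(\<lambda>\<nu>. restrict \<nu> {..<J}) ` F. \<Prod>j<J. x j ^ g j)"
    by (simp add: sum.reindex[OF inj])
  also have "\<dots> \<le> (\<Sum>g\<in>Pi\<^sub>E {..<J} (\<lambda>_. {..<M}). \<Prod>j<J. x j ^ g j)"
  proof (rule sum_mono2)
    show "(\<lambda>\<nu>. restrict \<nu> {..<J}) ` F \<subseteq> Pi\<^sub>E {..<J} (\<lambda>_. {..<M})"
      using M by (intro image_subsetI restrict_PiE_iff[THEN iffD2]) blast
  qed (use x0 in \<open>auto intro!: finite_PiE prod_nonneg\<close>)
  also have "\<dots> = (\<Prod>j<J. \<Sum>i<M. x j ^ i)"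
    by (rule prod_sum_PiE[symmetric]) auto
  also have "\<dots> \<le> (\<Prod>j<J. 2 powr (2 * x j))"
  proof (rule prod_mono, intro conjI)
    fix j
    show "0 \<le> (\<Sum>i<M. x j ^ i)" using x0 by (intro sum_nonneg) simp
    have "(\<Sum>i<M. x j ^ i) = (1 - x j ^ M) / (1 - x j)"
      using xh[of j] by (subst geometric_sum) (auto simp: field_simps)
    also have "\<dots> \<le> 1 / (1 - x j)"
      using xh[of j] x0[of j] by (intro divide_right_mono) auto
    also have "\<dots> \<le> 2 powr (2 * x j)"
      by (rule inverse_one_minus_le[OF x0 xh])
    finally show "(\<Sum>i<M. x j ^ i) \<le> 2 powr (2 * x j)" .
  qed
  also have "\<dots> = 2 powr (2 * (\<Sum>j<J. x j))"
    by (simp add: powr_sum[symmetric] sum_distrib_left)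
  also have "\<dots> \<le> 2 powr (2 * B)"
    using B by (intro powr_mono) auto
  finally show ?thesis .
qed

section \<open>The sequence \<open>rho_star\<close> on dyadic blocks\<close>

text \<open>Distinct blocks are disjoint, since an earlier one ends at \<open>2 ^ k1\<close> and a
  later one starts beyond \<open>2 ^ (k2 - 1)\<close>. Hence the definite description in
  \<open>rho_star\<close> has a unique solution.\<close>

lemma rho_star_block:
  assumes "1 \<le> k" "Suc j \<in> block k"
  shows "rho_star s j = 2 powr (real k * s)"
proof -
  have lt: "\<not> k1 < k2" if "1 \<le> k1" "Suc j \<in> block k1" "Suc j \<in> block k2" for k1 k2
  proof
    assume "k1 < k2"
    have "Suc j \<le> 2 ^ k1" using that by (auto simp: block_def split: if_splits)
    moreover have "2 ^ (k2 - 1) < Suc j"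
      using that \<open>k1 < k2\<close> by (auto simp: block_def split: if_splits)
    moreover have "(2::nat) ^ k1 \<le> 2 ^ (k2 - 1)"
      using \<open>k1 < k2\<close> by (intro power_increasing) auto
    ultimately show False by linarith
  qed
  have "(THE k. 1 \<le> k \<and> Suc j \<in> block k) = k"
    using assms lt by (intro the_equality) (auto, metis One_nat_def linorder_neqE_nat)
  then show ?thesis by (simp add: rho_star_def)
qed

lemma rho_star_0: "rho_star s 0 = 2 powr s"
  using rho_star_block[of 1 0] by (simp add: block_def)

text \<open>The shift by one turns the blocks, open on the left, into the dyadic intervals starting
  at \<open>2 ^ K\<close>. Only \<open>j = 0\<close>, the first element of block 1, lies outside all
  of them.\<close>

lemma rho_star_dyadic:
  assumes "2 ^ K \<le> j" "j < 2 ^ Suc K"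
  shows "rho_star s j = 2 powr (real (Suc K) * s)"
proof (rule rho_star_block)
  show "Suc j \<in> block (Suc K)"
    using assms by (cases K) (auto simp: block_def)
qed simp

lemma rho_star_cases:
  fixes j :: nat
  obtains "j = 0" | K where "2 ^ K \<le> j" "j < 2 ^ Suc K"
proof (cases "j = 0")
  case False
  then obtain K where "2 ^ K \<le> j" "j < 2 ^ (K + 1)"
    using ex_power_ivl1[of 2 j] by auto
  then show ?thesis using that by simp
qed (use that in auto)

lemma rho_star_ge:
  assumes "0 < s"
  shows "2 powr s \<le> rho_star s j"
proof (cases rule: rho_star_cases[of j])
  case (2 K)
  have "s \<le> real (Suc K) * s" using assms by simp
  then show ?thesis by (simp only: rho_star_dyadic[OF 2]) (simp add: powr_mono)
qed (simp add: rho_star_0)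

text \<open>The dyadic interval with index \<open>K\<close> has \<open>2 ^ K\<close> equal terms,
  which add up to half of \<open>r ^ Suc K\<close> with \<open>r = 2 powr (- h)\<close>. The term at
  0 gives at most 1/2, and half the geometric series gives at most \<open>1 / h\<close>.\<close>

lemma sum_rho_star_le:
  assumes s: "0 < s" and h: "0 < h"
  shows "(\<Sum>j<J. rho_star s j powr (- (1 + h) / s)) \<le> 1/2 + 1/h"
proof -
  define x where "x j = rho_star s j powr (- (1 + h) / s)" for j
  define r where "r = (2::real) powr (- h)"
  have r: "0 < r" "r < 1"
    using h by (auto simp: r_def powr_less_one)
  have x: "x j = 2 powr (- (1 + h) * real (Suc K))" if "2 ^ K \<le> j" "j < 2 ^ Suc K" for j K
  proof -
    have "real (Suc K) * s * (- (1 + h) / s) = - (1 + h) * real (Suc K)" using s by simp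
    then show ?thesis unfolding x_def rho_star_dyadic[OF that] powr_powr by (rule arg_cong)
  qed
  have dyadic: "(\<Sum>j<2 ^ K. x j) \<le> 1/2 + (1/2) * (\<Sum>k<K. r ^ Suc k)" for K
  proof (induction K)
    case 0
    have "x 0 = 2 powr (- (1 + h))"
      using s by (simp add: x_def rho_star_0 powr_powr)
    also have "\<dots> \<le> 2 powr (-1)" using h by (intro powr_mono) auto
    finally show ?case by (simp add: powr_minus)
  next
    case (Suc K)
    have split: "{..<2 ^ Suc K} = {..<2 ^ K} \<union> {2 ^ K..<2 ^ Suc K :: nat}" by auto
    have "(\<Sum>j<2 ^ Suc K. x j) = (\<Sum>j<2 ^ K. x j) + (\<Sum>j=2 ^ K..<2 ^ Suc K. x j)"
      by (subst split, rule sum.union_disjoint) auto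
    also have "(\<Sum>j=2 ^ K..<2 ^ Suc K. x j)
        = (\<Sum>j=2 ^ K..<2 ^ Suc K::nat. 2 powr (- (1 + h) * real (Suc K)))"
      by (rule sum.cong) (use x in auto)
    also have "\<dots> = 2 ^ K * 2 powr (- (1 + h) * real (Suc K))" by simp
    also have "\<dots> = 2 powr (real K + - (1 + h) * real (Suc K))"
      by (subst powr_add) (simp add: powr_realpow)
    also have "real K + - (1 + h) * real (Suc K) = -1 + (- h) * real (Suc K)"
      by (simp add: algebra_simps)
    also have "2 powr \<dots> = (1/2) * r ^ Suc K"
      unfolding r_def powr_add by (subst powr_powr[symmetric], subst powr_realpow) (auto simp: powr_minus)
    finally show ?case using Suc.IH by (simp add: algebra_simps)
  qed
  have "(\<Sum>j<J. x j) \<le> (\<Sum>j<2 ^ J. x j)"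
    by (rule sum_mono2) (auto simp: x_def intro: less_trans less_exp)
  also have "\<dots> \<le> 1/2 + (1/2) * (\<Sum>k<J. r ^ Suc k)" by (rule dyadic)
  also have "(\<Sum>k<J. r ^ Suc k) = r * (\<Sum>k<J. r ^ k)"
    by (simp add: sum_distrib_left)
  also have "(\<Sum>k<J. r ^ k) \<le> 1 / (1 - r)"
    using r by (simp add: sum_gp_strict divide_right_mono)
  also have "r * (1 / (1 - r)) = 1 / (2 powr h - 1)"
    using r by (simp add: r_def powr_minus field_simps)
  \<comment> \<open>Linearising the exponential gives \<open>2 powr h \<ge> 1 + h * ln 2\<close>,
    and \<open>ln 2\<close> is at least 1/2.\<close>
  also have "\<dots> \<le> 2 / h"
  proof -
    have "ln 2 \<ge> (1/2 :: real)" using ln2_ge_two_thirds by linarith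
    then have "1 + h / 2 \<le> 1 + h * ln 2" using h by (simp add: field_simps)
    also have "\<dots> \<le> 2 powr h" by (simp add: powr_def exp_ge_add_one_self)
    finally have "h / 2 \<le> 2 powr h - 1" by simp
    then have "1 / (2 powr h - 1) \<le> 1 / (h / 2)" using h by (intro divide_left_mono mult_pos_pos) auto
    then show ?thesis by simp
  qed
  finally show ?thesis using r by (simp add: x_def)
qed

text \<open>The Euler product bound for \<open>x j = rho_star s j powr (- (1 + h) / s)\<close>.
  These numbers are at most 1/2 because every weight is at least \<open>2 powr s\<close>, and their
  sum is at most \<open>1/2 + 1/h\<close>.\<close>

lemma sum_mpow_rho_star_le:
  assumes "0 < s" "0 < h" "finite F" "F \<subseteq> multi_indices"
  shows "(\<Sum>\<nu>\<in>F. (1 / mpow (rho_star s) \<nu>) powr ((1 + h) / s)) \<le> 2 powr (1 + 2 / h)"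
proof -
  define x where "x j = rho_star s j powr (- (1 + h) / s)" for j
  have pos: "0 < rho_star s j" for j using rho_star_ge[OF assms(1), of j] by (smt (verit) powr_gt_zero)
  have xh: "x j \<le> 1/2" for j
  proof -
    have "x j \<le> (2 powr s) powr (- (1 + h) / s)"
      unfolding x_def using assms by (intro powr_mono2' rho_star_ge) (auto simp: field_simps)
    also have "\<dots> = 2 powr (- (1 + h))" using assms by (simp add: powr_powr)
    also have "\<dots> \<le> 2 powr (-1)" using assms by (intro powr_mono) auto
    finally show ?thesis by (simp add: powr_minus)
  qed
  have "(1 / mpow (rho_star s) \<nu>) powr ((1 + h) / s) = mpow x \<nu>" for \<nu>
    unfolding x_def mpow_powr[OF pos]
    using mpow_pos[of "rho_star s" \<nu>, OF pos]
    by (simp only: powr_divide powr_minus_divide minus_divide_left powr_one_eq_one)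
      (metis minus_divide_left powr_minus_divide)
  then have "(\<Sum>\<nu>\<in>F. (1 / mpow (rho_star s) \<nu>) powr ((1 + h) / s)) = (\<Sum>\<nu>\<in>F. mpow x \<nu>)" by simp
  also have "\<dots> \<le> 2 powr (2 * (1/2 + 1/h))"
    by (rule sum_mpow_le) (use assms xh sum_rho_star_le in \<open>auto simp: x_def\<close>)
  finally show ?thesis by (simp add: algebra_simps)
qed

section \<open>Existence of the decreasing rearrangement\<close>

text \<open>\<open>A\<close> is countable as a union of finite sublevel sets, so ties in
  \<open>w\<close> can be broken by an injection into the naturals. Every element then has finitely
  many predecessors, and their number \<open>r\<close> is injective and respects the order.\<close>

lemma nondecreasing_enumeration:
  fixes w :: "'i \<Rightarrow> real"
  assumes inf: "infinite A" and fin: "\<And>c. finite {a \<in> A. w a \<le> c}"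
  obtains \<pi> :: "nat \<Rightarrow> 'i"
  where "bij_betw \<pi> UNIV A" "\<And>i j. i \<le> j \<Longrightarrow> w (\<pi> i) \<le> w (\<pi> j)"
proof -
  have "A = (\<Union>n. {a \<in> A. w a \<le> real n})"
    using real_arch_simple by auto
  moreover have "countable (\<Union>n. {a \<in> A. w a \<le> real n})"
    using fin by (intro countable_UN) (auto intro: countable_finite)
  ultimately have "countable A" by simp
  then have inj_e: "inj_on (to_nat_on A) A" by (rule inj_on_to_nat_on)
  define lt where
    "lt b a \<longleftrightarrow> w b < w a \<or> w b = w a \<and> to_nat_on A b < to_nat_on A a" for a b
  define r where "r a = card {b \<in> A. lt b a}" for a
  have mono: "r b < r a" if "b \<in> A" "lt b a" for a b
    unfolding r_def
  proof (rule psubset_card_mono)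
    show "finite {b \<in> A. lt b a}"
      by (rule finite_subset[OF _ fin[of "w a"]]) (auto simp: lt_def)
    show "{c \<in> A. lt c b} \<subset> {b \<in> A. lt b a}"
      using that by (auto simp: lt_def)
  qed
  have total: "lt a b \<or> lt b a" if "a \<in> A" "b \<in> A" "a \<noteq> b" for a b
  proof -
    have "to_nat_on A a \<noteq> to_nat_on A b" using that inj_onD[OF inj_e] by blast
    then show ?thesis
      unfolding lt_def
      using less_linear[of "w a" "w b"] less_linear[of "to_nat_on A a" "to_nat_on A b"] by argo
  qed
  have inj_r: "inj_on r A"
  proof (rule inj_onI, rule ccontr)
    fix a b assume "a \<in> A" "b \<in> A" "r a = r b" "a \<noteq> b"
    then show False using total[of a b] mono[of a b] mono[of b a] by linarith
  qed
  then have "infinite (r ` A)" using inf finite_imageD by blast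
  then have en: "bij_betw (enumerate (r ` A)) UNIV (r ` A)" by (rule bij_enumerate)
  have inv: "bij_betw (inv_into A r) (r ` A) A"
    using inj_r by (simp add: bij_betw_inv_into inj_on_imp_bij_betw)
  \<comment> \<open>\<open>enumerate\<close> lists the ranks increasingly; inverting
    \<open>r\<close> turns this into a list of the elements of \<open>A\<close> ordered by
    \<open>lt\<close>.\<close>
  define \<pi> where "\<pi> = inv_into A r \<circ> enumerate (r ` A)"
  have bij: "bij_betw \<pi> UNIV A"
    unfolding \<pi>_def using en inv by (rule bij_betw_trans)
  have r\<pi>: "r (\<pi> i) = enumerate (r ` A) i" for i
    using f_inv_into_f[OF enumerate_in_set[OF \<open>infinite (r ` A)\<close>]] by (simp add: \<pi>_def)
  show ?thesis
  proof (rule that[OF bij])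
    fix i j :: nat assume "i \<le> j"
    then have "r (\<pi> i) \<le> r (\<pi> j)"
      unfolding r\<pi> using \<open>infinite (r ` A)\<close> by simp
    then have "\<not> lt (\<pi> j) (\<pi> i)"
      using mono[of "\<pi> j" "\<pi> i"] bij_betwE[OF bij] by force
    then show "w (\<pi> i) \<le> w (\<pi> j)" by (auto simp: lt_def)
  qed
qed

text \<open>Chebyshev's counting argument: each \<open>a\<close> with \<open>w a \<le> c\<close>
  contributes at least \<open>(1 / c) powr \<beta>\<close> to a sum bounded by \<open>S\<close>, so
  there are at most \<open>S * c powr \<beta>\<close> of them.\<close>

lemma finite_sublevel:
  fixes w :: "'i \<Rightarrow> real"
  assumes w: "\<And>a. a \<in> A \<Longrightarrow> 0 < w a" and \<beta>: "0 < \<beta>"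
    and S: "\<And>F. finite F \<Longrightarrow> F \<subseteq> A \<Longrightarrow> (\<Sum>a\<in>F. (1 / w a) powr \<beta>) \<le> S"
  shows "finite {a \<in> A. w a \<le> c}"
proof (rule ccontr)
  assume inf: "infinite {a \<in> A. w a \<le> c}"
  then obtain a where "a \<in> A" "w a \<le> c" using not_finite_existsD by blast
  with w have c: "0 < c" by fastforce
  obtain N :: nat where N: "S * c powr \<beta> < real N" using reals_Archimedean2 by blast
  obtain F where F: "finite F" "card F = N" "F \<subseteq> {a \<in> A. w a \<le> c}"
    using infinite_arbitrarily_large[OF inf] by blast
  have "real N * (1 / c) powr \<beta> = (\<Sum>a\<in>F. (1 / c) powr \<beta>)" using F by simp
  also have "\<dots> \<le> (\<Sum>a\<in>F. (1 / w a) powr \<beta>)"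
    using F w c \<beta> by (intro sum_mono powr_mono2 divide_left_mono) auto
  also have "\<dots> \<le> S" using F by (intro S) auto
  finally have "real N \<le> S * c powr \<beta>"
    using c by (simp add: powr_divide field_simps)
  with N show False by simp
qed

lemma infinite_multi_indices: "infinite multi_indices"
proof
  define e where "e n j = (if j = 0 then n else 0)" for n j :: nat
  assume "finite multi_indices"
  moreover have "range e \<subseteq> multi_indices"
    by (auto simp: e_def multi_indices_def intro: finite_subset[of _ "{0}"])
  ultimately have "finite (range e)" by (rule rev_finite_subset)
  moreover have "inj e" by (rule injI) (metis e_def)
  ultimately show False using finite_imageD infinite_UNIV_nat by blast
qed

text \<open>Exhibits a sequence with the property under the \<open>SOME\<close> in
  \<open>decr_rearr\<close>, so that the chosen sequence has this property too.\<close>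

lemma decr_rearr_enumeration:
  assumes fin: "\<And>c. finite {\<nu> \<in> multi_indices. mpow \<rho> \<nu> \<le> c}"
    and pos: "\<And>\<nu>. 0 < mpow \<rho> \<nu>"
  obtains \<pi> where "bij_betw \<pi> {1..} multi_indices"
    "\<And>j. 1 \<le> j \<Longrightarrow> decr_rearr \<rho> j = 1 / mpow \<rho> (\<pi> j)"
    "\<And>i j. 1 \<le> i \<Longrightarrow> i \<le> j \<Longrightarrow> decr_rearr \<rho> j \<le> decr_rearr \<rho> i"
proof -
  obtain \<pi> :: "nat \<Rightarrow> nat \<Rightarrow> nat" where \<pi>: "bij_betw \<pi> UNIV multi_indices"
    "\<And>i j. i \<le> j \<Longrightarrow> mpow \<rho> (\<pi> i) \<le> mpow \<rho> (\<pi> j)"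
    using nondecreasing_enumeration[of multi_indices "mpow \<rho>", OF infinite_multi_indices fin] by metis
  have pred: "bij_betw (\<lambda>j. j - 1) {1..} (UNIV :: nat set)"
    by (rule bij_betw_byWitness[where f' = Suc]) auto
  define \<sigma> where "\<sigma> j = \<pi> (j - 1)" for j
  have "bij_betw \<sigma> {1..} multi_indices"
    using bij_betw_trans[OF pred \<pi>(1)] by (simp add: \<sigma>_def[abs_def] comp_def)
  moreover have "1 / mpow \<rho> (\<sigma> j) \<le> 1 / mpow \<rho> (\<sigma> i)" if "i \<le> j" for i j
    unfolding \<sigma>_def using \<pi>(2)[of "i - 1" "j - 1"] that pos by (intro divide_left_mono) auto
  ultimately have "\<exists>(d :: nat \<Rightarrow> real) \<pi>. bij_betw \<pi> {1..} multi_indices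
      \<and> (\<forall>j\<ge>1. d j = 1 / mpow \<rho> (\<pi> j)) \<and> (\<forall>i\<ge>1. \<forall>j\<ge>i. d j \<le> d i)"
    by (intro exI[of _ "\<lambda>j. 1 / mpow \<rho> (\<sigma> j)"] exI[of _ \<sigma>]) auto
  from someI_ex[OF this, folded decr_rearr_def] show ?thesis using that by metis
qed

section \<open>Hoelder and Stechkin inequalities\<close>

text \<open>Moves the conjugacy relation from \<open>ennreal\<close> to the reals. A nonpositive
  \<open>q\<close> would become 0 in \<open>ennreal\<close>, making \<open>1 / ennreal q\<close>
  infinite; an infinite \<open>p\<close> contributes 0 and forces \<open>q = 1\<close>.\<close>

lemma conjugate_exponent_cases:
  fixes p :: ennreal and q :: real
  assumes "1 < p" "1 / p + 1 / ennreal q = 1"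
  obtains "p = \<infinity>" "q = 1"
  | r where "p = ennreal r" "1 < r" "1 < q" "1 / r + 1 / q = 1"
proof -
  have q: "0 < q"
  proof (rule ccontr)
    assume "\<not> 0 < q"
    then have "ennreal q = 0" by (simp add: ennreal_eq_0_iff)
    then show False using assms(2) by (simp add: ennreal_divide_zero)
  qed
  have iq: "1 / ennreal q = ennreal (1 / q)"
    using divide_ennreal[of 1 q] q by simp
  show ?thesis
  proof (cases p)
    case (real r)
    then have r: "1 < r" using assms(1) by (metis ennreal_le_1 linorder_not_le)
    have "1 / p = ennreal (1 / r)" using divide_ennreal[of 1 r] real r by simp
    then have "ennreal (1 / r + 1 / q) = 1"
      using r q iq assms(2) by (simp add: ennreal_plus)
    then have "1 / r + 1 / q = 1" by simp
    moreover have "0 < 1 / r" using r by simp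
    then have "1 / q < 1" using calculation by linarith
    then have "1 < q" using q by (simp add: field_simps)
    ultimately show ?thesis using real r that(2) by simp
  next
    case top
    then have "ennreal (1 / q) = 1" using assms(2) iq by simp
    then have "q = 1" using q by simp
    then show ?thesis using top that(1) by simp
  qed
qed

text \<open>Termwise for \<open>p = \<infinity>\<close>, by Young's inequality otherwise; if
  \<open>b\<close> is not in the sequence space, the right side is infinite. The map
  \<open>h\<close> allows \<open>b\<close> to be indexed by positions and \<open>a\<close> by
  multi-indices.\<close>

lemma Holder_unit_lp_norm:
  fixes a :: "'i \<Rightarrow> real" and b :: "'j \<Rightarrow> real"
  assumes pq: "1 < p" "1 / p + 1 / ennreal q = 1"
    and a: "\<And>i. 0 \<le> a i" "lp_norm p A a \<le> 1"
    and I: "finite I" "inj_on h I" "h ` I \<subseteq> A" "I \<subseteq> B" and b: "\<And>i. i \<in> B \<Longrightarrow> 0 \<le> b i"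
  shows "ennreal (\<Sum>i\<in>I. a (h i) * b i) \<le> lp_norm (ennreal q) B b"
proof (cases "(\<lambda>i. \<bar>b i\<bar> powr enn2real (ennreal q)) summable_on B")
  case False
  then show ?thesis by (simp add: lp_norm_def)
next
  case True
  have q: "0 < q" using pq by (rule conjugate_exponent_cases) auto
  have sm: "(\<lambda>i. b i powr q) summable_on B"
    using True q b by (simp cong: summable_on_cong)
  have norm_b: "lp_norm (ennreal q) B b = ennreal ((\<Sum>\<^sub>\<infinity>i\<in>B. b i powr q) powr (1 / q))"
    using True q b by (simp add: lp_norm_def cong: infsum_cong)
  have "(\<Sum>i\<in>I. b i powr q) \<le> (\<Sum>\<^sub>\<infinity>i\<in>B. b i powr q)"
    by (rule finite_sum_le_infsum[OF sm I(1,4)]) simp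
  then have le: "(\<Sum>i\<in>I. b i powr q) powr (1 / q) \<le> (\<Sum>\<^sub>\<infinity>i\<in>B. b i powr q) powr (1 / q)"
    using q by (intro powr_mono2) (auto intro: sum_nonneg)
  have bI: "0 \<le> b i" if "i \<in> I" for i using that I b by auto
  have "(\<Sum>i\<in>I. a (h i) * b i) \<le> (\<Sum>i\<in>I. b i powr q) powr (1 / q)"
    using pq
  proof (rule conjugate_exponent_cases)
    assume "p = \<infinity>" "q = 1"
    have "a (h i) \<le> 1" if "i \<in> I" for i
    proof -
      have "ennreal \<bar>a (h i)\<bar> \<le> lp_norm p A a"
        unfolding lp_norm_def using \<open>p = \<infinity>\<close> that I by (auto intro!: SUP_upper)
      then have "ennreal \<bar>a (h i)\<bar> \<le> 1" using a(2) by (rule order_trans)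
      then show ?thesis by simp
    qed
    then have "(\<Sum>i\<in>I. a (h i) * b i) \<le> (\<Sum>i\<in>I. b i)"
      by (intro sum_mono mult_left_le_one_le bI a)
    then show ?thesis using bI \<open>q = 1\<close> by (simp add: sum_nonneg)
  next
    fix r assume r: "p = ennreal r" "1 < r" "1 < q" "1 / r + 1 / q = 1"
    have sa: "(\<lambda>i. a i powr r) summable_on A" "(\<Sum>\<^sub>\<infinity>i\<in>A. a i powr r) powr (1 / r) \<le> 1"
      using a r by (auto simp: lp_norm_def top_unique split: if_splits)
    have "(\<Sum>\<^sub>\<infinity>i\<in>A. a i powr r) \<le> 1"
    proof (rule ccontr)
      assume "\<not> ?thesis"
      then have "1 < (\<Sum>\<^sub>\<infinity>i\<in>A. a i powr r) powr (1 / r)"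
        using r by (intro gr_one_powr) auto
      with sa show False by simp
    qed
    moreover have "(\<Sum>i\<in>I. a (h i) powr r) = (\<Sum>i\<in>h ` I. a i powr r)"
      using I by (simp add: sum.reindex)
    moreover have "\<dots> \<le> (\<Sum>\<^sub>\<infinity>i\<in>A. a i powr r)"
      using I by (intro finite_sum_le_infsum sa) auto
    ultimately have a1: "(\<Sum>i\<in>I. a (h i) powr r) \<le> 1" by simp
    define D where "D = (\<Sum>i\<in>I. b i powr q) powr (1 / q)"
    show ?thesis
    proof (cases "(\<Sum>i\<in>I. b i powr q) = 0")
      case True
      then have "b i = 0" if "i \<in> I" for i
        using I that by (subst (asm) sum_nonneg_eq_0_iff) auto
      then show ?thesis by simp
    next
      case False
      have sb: "0 < (\<Sum>i\<in>I. b i powr q)" using False sum_nonneg[of I "\<lambda>i. b i powr q"] by force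
      then have D: "0 < D" "D powr q = (\<Sum>i\<in>I. b i powr q)"
        using q by (auto simp: D_def powr_powr)
      \<comment> \<open>Dividing by \<open>D\<close> gives \<open>b\<close> unit norm on
        \<open>I\<close>, so the two sums from Young's inequality add up to at most
        \<open>1 / r + 1 / q = 1\<close>.\<close>
      have "(\<Sum>i\<in>I. a (h i) * b i) / D = (\<Sum>i\<in>I. a (h i) * (b i / D))"
        by (simp add: sum_divide_distrib)
      also have "\<dots> \<le> (\<Sum>i\<in>I. a (h i) powr r / r + (b i / D) powr q / q)"
        using r a bI D by (intro sum_mono Youngs_inequality) auto
      also have "\<dots> = (\<Sum>i\<in>I. a (h i) powr r) / r + (\<Sum>i\<in>I. b i powr q / D powr q) / q"
        using bI D by (simp add: sum.distrib sum_divide_distrib powr_divide cong: sum.cong)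
      also have "(\<Sum>i\<in>I. b i powr q / D powr q) = 1"
        using D sb by (simp flip: sum_divide_distrib)
      also have "(\<Sum>i\<in>I. a (h i) powr r) / r + 1 / q \<le> 1 / r + 1 / q"
        using a1 r(2) by (intro add_right_mono divide_right_mono) auto
      finally show ?thesis using D r by (simp add: D_def)
    qed
  qed
  with le show ?thesis unfolding norm_b by (intro ennreal_leI) simp
qed

text \<open>Stechkin's inequality: \<open>n d\<^sub>n\<^sup>\<beta>\<close> is at most the full sum, which controls the factor
  \<open>d\<^sub>j\<^sup>q\<^sup>-\<^sup>\<beta>\<close> of each term of the tail.\<close>

lemma lp_norm_tail_le:
  fixes d :: "nat \<Rightarrow> real"
  assumes d: "\<And>j. 1 \<le> j \<Longrightarrow> 0 \<le> d j" and mono: "\<And>i j. 1 \<le> i \<Longrightarrow> i \<le> j \<Longrightarrow> d j \<le> d i"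
    and S: "\<And>F. finite F \<Longrightarrow> F \<subseteq> {1..} \<Longrightarrow> (\<Sum>j\<in>F. d j powr \<beta>) \<le> S"
    and \<beta>: "0 < \<beta>" "\<beta> \<le> q" and n: "1 \<le> n"
  shows "lp_norm (ennreal q) {n<..} d \<le> ennreal (real n powr (1 / q - 1 / \<beta>) * S powr (1 / \<beta>))"
proof -
  have S0: "0 \<le> S" using S[of "{}"] by simp
  have "real n * d n powr \<beta> = (\<Sum>j\<in>{1..n}. d n powr \<beta>)" by simp
  also have "\<dots> \<le> (\<Sum>j\<in>{1..n}. d j powr \<beta>)"
    using \<beta> n by (intro sum_mono powr_mono2 mono d) auto
  also have "\<dots> \<le> S" by (rule S) auto
  finally have dn: "d n powr \<beta> \<le> S / real n" using n by (simp add: field_simps)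
  define E where "E = (S / real n) powr ((q - \<beta>) / \<beta>) * S"
  have sum_le: "(\<Sum>j\<in>F. d j powr q) \<le> E" if F: "finite F" "F \<subseteq> {n<..}" for F
  proof -
    have "(\<Sum>j\<in>F. d j powr q) \<le> (\<Sum>j\<in>F. (S / real n) powr ((q - \<beta>) / \<beta>) * d j powr \<beta>)"
    proof (rule sum_mono)
      fix j assume "j \<in> F"
      then have j: "n \<le> j" using F by auto
      have "d j powr (q - \<beta>) \<le> d n powr (q - \<beta>)"
        using \<beta> n j by (intro powr_mono2 mono d) auto
      also have "\<dots> = (d n powr \<beta>) powr ((q - \<beta>) / \<beta>)" using \<beta> by (simp add: powr_powr)
      also have "\<dots> \<le> (S / real n) powr ((q - \<beta>) / \<beta>)"
        using dn \<beta> by (intro powr_mono2) auto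
      finally have "d j powr (q - \<beta>) * d j powr \<beta> \<le> (S / real n) powr ((q - \<beta>) / \<beta>) * d j powr \<beta>"
        by (rule mult_right_mono) simp
      then show "d j powr q \<le> (S / real n) powr ((q - \<beta>) / \<beta>) * d j powr \<beta>"
        by (simp flip: powr_add)
    qed
    also have "\<dots> \<le> E"
      unfolding E_def sum_distrib_left[symmetric] using F n by (intro mult_left_mono S) auto
    finally show ?thesis .
  qed
  have abs_eq: "\<bar>d j\<bar> powr q = d j powr q" if "j \<in> {n<..}" for j
    using that d[of j] by simp
  have summable_eq: "(\<lambda>j. \<bar>d j\<bar> powr q) summable_on {n<..} \<longleftrightarrow> (\<lambda>j. d j powr q) summable_on {n<..}"
    using abs_eq by (rule summable_on_cong)
  have infsum_eq: "(\<Sum>\<^sub>\<infinity>j\<in>{n<..}. \<bar>d j\<bar> powr q) = (\<Sum>\<^sub>\<infinity>j\<in>{n<..}. d j powr q)"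
    using abs_eq by (rule infsum_cong)
  have sm: "(\<lambda>j. d j powr q) summable_on {n<..}"
    by (rule nonneg_bdd_above_summable_on) (use sum_le in \<open>auto intro!: bdd_aboveI[where M = E]\<close>)
  have "(\<Sum>\<^sub>\<infinity>j\<in>{n<..}. d j powr q) \<le> E"
    by (rule infsum_le_finite_sums[OF sm sum_le])
  then have "(\<Sum>\<^sub>\<infinity>j\<in>{n<..}. d j powr q) powr (1 / q) \<le> E powr (1 / q)"
    using \<beta> by (intro powr_mono2) (auto intro: infsum_nonneg)
  \<comment> \<open>Merging the powers in \<open>E\<close> cancels a factor \<open>S\<close> and so
    requires it to be nonzero; for \<open>S = 0\<close> both sides vanish.\<close>
  also have "E powr (1 / q) = real n powr (1 / q - 1 / \<beta>) * S powr (1 / \<beta>)"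
  proof (cases "S = 0")
    case False
    then have "E = S powr (q / \<beta>) * real n powr (1 - q / \<beta>)"
      unfolding E_def using S0 \<beta> n
      by (simp add: powr_divide diff_divide_distrib powr_diff)
    then show ?thesis
      using \<beta> by (simp add: powr_mult powr_powr diff_divide_distrib left_diff_distrib mult.commute)
  qed (simp add: E_def)
  finally show ?thesis
    using \<beta> sm
    by (simp add: lp_norm_def ennreal_leI summable_eq infsum_eq)
qed

section \<open>Truncation of the power series\<close>

text \<open>The set \<open>\<Lambda>\<close> of the first \<open>n\<close> multi-indices is fixed
  before \<open>u\<close> and serves the whole ball, as the infimum outside the supremum
  demands.\<close>

lemma approx_error_le_delta_tail:
  fixes p :: ennreal and q :: real
  assumes \<rho>: "\<And>j. 1 < \<rho> j"
    and fin: "\<And>c. finite {\<nu> \<in> multi_indices. mpow \<rho> \<nu> \<le> c}"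
    and pq: "1 < p" "1 / p + 1 / ennreal q = 1"
  shows "approx_error n (U_ball \<rho> p :: ((nat \<Rightarrow> real) \<Rightarrow> 'a::real_normed_vector) set)
    \<le> delta_tail \<rho> n q"
proof -
  have pos: "0 < mpow \<rho> \<nu>" for \<nu>
    using \<rho> by (intro mpow_pos) (meson less_trans zero_less_one)
  obtain \<pi> where \<pi>: "bij_betw \<pi> {1..} multi_indices"
    and d: "\<And>j. 1 \<le> j \<Longrightarrow> decr_rearr \<rho> j = 1 / mpow \<rho> (\<pi> j)"
    and mono: "\<And>i j. 1 \<le> i \<Longrightarrow> i \<le> j \<Longrightarrow> decr_rearr \<rho> j \<le> decr_rearr \<rho> i"
    using decr_rearr_enumeration[OF fin pos] by blast
  have inj: "inj_on \<pi> {1..}" and img: "\<pi> ` {1..} = multi_indices"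
    using \<pi> by (auto simp: bij_betw_def)
  define \<Lambda> where "\<Lambda> = \<pi> ` {1..n}"
  have inj_n: "inj_on \<pi> {1..n}" using inj by (rule inj_on_subset) auto
  have "lower_set \<Lambda>"
    unfolding lower_set_def
  proof (intro conjI ballI impI)
    show "\<Lambda> \<subseteq> multi_indices" using img by (auto simp: \<Lambda>_def)
    fix \<nu> \<mu> assume \<nu>: "\<nu> \<in> \<Lambda>" and \<mu>: "\<mu> \<in> multi_indices" and le: "\<forall>j. \<mu> j \<le> \<nu> j"
    obtain i where i: "\<nu> = \<pi> i" "1 \<le> i" "i \<le> n" using \<nu> by (auto simp: \<Lambda>_def)
    obtain j where j: "\<mu> = \<pi> j" "1 \<le> j" using \<mu> img by (metis atLeast_iff imageE)
    show "\<mu> \<in> \<Lambda>"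
    proof (cases "\<mu> = \<nu>")
      case False
      have "mpow \<rho> \<mu> < mpow \<rho> \<nu>"
        using \<nu> \<open>\<Lambda> \<subseteq> multi_indices\<close> le False by (intro mpow_strict_mono \<rho>) auto
      \<comment> \<open>Strictness is essential: equal values would not determine which of the
        positions \<open>i\<close> and \<open>j\<close> comes first.\<close>
      then have "decr_rearr \<rho> i < decr_rearr \<rho> j"
        using d i j pos by (simp add: frac_less2)
      then have "j \<le> i" using mono[OF i(2), of j] by force
      then show ?thesis using i j by (auto simp: \<Lambda>_def)
    qed (use \<nu> in simp)
  qed
  moreover have "card \<Lambda> \<le> n" using card_image_le[of "{1..n}" \<pi>] by (simp add: \<Lambda>_def)
  ultimately have \<Lambda>: "\<Lambda> \<in> lower_sets n" by (simp add: lower_sets_def \<Lambda>_def)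
  show ?thesis
    unfolding approx_error_def
  proof (rule INF_lower2[OF \<Lambda>], rule SUP_least)
    fix u :: "(nat \<Rightarrow> real) \<Rightarrow> 'a" assume u: "u \<in> U_ball \<rho> p"
    define t where "t = (THE t. power_series_rep u t)"
    define a where "a \<nu> = mpow \<rho> \<nu> * norm (t \<nu>)" for \<nu>
    have "\<exists>!t. power_series_rep u t" using u by (simp add: U_ball_def B_space_def)
    then have rep: "power_series_rep u t" unfolding t_def by (rule theI')
    have a: "lp_norm p multi_indices a \<le> 1"
      using u by (simp add: U_ball_def B_norm_def a_def[abs_def] t_def)
    have a0: "0 \<le> a \<nu>" for \<nu> using pos[of \<nu>] by (simp add: a_def)
    define P where "P y = (\<Sum>\<nu>\<in>\<Lambda>. mpow y \<nu> *\<^sub>R t \<nu>)" for y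
    have P: "P \<in> poly_space \<Lambda>" unfolding poly_space_def P_def[abs_def] by blast
    show "(INF P\<in>poly_space \<Lambda>. Linf_norm (\<lambda>y. u y - P y)) \<le> delta_tail \<rho> n q"
      unfolding Linf_norm_def
    proof (rule INF_lower2[OF P], rule SUP_least)
      fix y assume y: "y \<in> Y_dom"
      define f where "f j = mpow y (\<pi> j) *\<^sub>R t (\<pi> j)" for j
      \<comment> \<open>Unconditional convergence is applied to the decreasing enumeration,
        precomposed with \<open>Suc\<close> because \<open>power_series_rep\<close> counts from 0
        and \<open>\<pi>\<close> from 1.\<close>
      have Suc: "bij_betw Suc UNIV {1..}"
        by (rule bij_betw_byWitness[where f' = "\<lambda>j. j - 1"]) auto
      have "uniform_limit Y_dom (\<lambda>m y. \<Sum>i<m. mpow y ((\<pi> \<circ> Suc) i) *\<^sub>R t ((\<pi> \<circ> Suc) i)) u sequentially"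
        using rep bij_betw_trans[OF Suc \<pi>] unfolding power_series_rep_def by blast
      then have "(\<lambda>m. \<Sum>i<m. f (Suc i)) \<longlonglongrightarrow> u y"
        using y by (auto dest: tendsto_uniform_limitI simp: f_def)
      then have "(\<lambda>m. \<Sum>j=1..m. f j) \<longlonglongrightarrow> u y" by (simp add: sum.atLeast1_atMost_eq)
      then have lim: "(\<lambda>m. (\<Sum>j=1..m. f j) - P y) \<longlonglongrightarrow> u y - P y"
        by (intro tendsto_intros)
      have Py: "P y = (\<Sum>j=1..n. f j)"
        unfolding P_def \<Lambda>_def f_def by (subst sum.reindex[OF inj_n]) simp
      \<comment> \<open>Only finite sums are estimated; the bound is free of \<open>m\<close> and
        survives the passage to the limit.\<close>
      have bound: "ennreal (norm ((\<Sum>j=1..m. f j) - P y)) \<le> delta_tail \<rho> n q" if "n \<le> m" for m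
      proof -
        have split: "{1..m} = {1..n} \<union> {n<..m}" using that by auto
        have "(\<Sum>j=1..m. f j) = (\<Sum>j=1..n. f j) + (\<Sum>j\<in>{n<..m}. f j)"
          by (subst split, rule sum.union_disjoint) auto
        then have "(\<Sum>j=1..m. f j) - P y = (\<Sum>j\<in>{n<..m}. f j)" by (simp add: Py)
        \<comment> \<open>The norm of a coefficient is its weighted norm \<open>a (\<pi> j)\<close>,
          controlled by the unit ball, times the reciprocal weight
          \<open>decr_rearr \<rho> j\<close>.\<close>
        also have "norm \<dots> \<le> (\<Sum>j\<in>{n<..m}. a (\<pi> j) * decr_rearr \<rho> j)"
        proof (rule sum_norm_le)
          fix j assume "j \<in> {n<..m}"
          then have "a (\<pi> j) * decr_rearr \<rho> j = norm (t (\<pi> j))"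
            using d[of j] pos[of "\<pi> j"] by (simp add: a_def)
          moreover have "norm (f j) \<le> 1 * norm (t (\<pi> j))"
            unfolding f_def norm_scaleR using abs_mpow_le_1[OF y]
            by (intro mult_right_mono) auto
          ultimately show "norm (f j) \<le> a (\<pi> j) * decr_rearr \<rho> j" by simp
        qed
        finally have "ennreal (norm ((\<Sum>j=1..m. f j) - P y))
            \<le> ennreal (\<Sum>j\<in>{n<..m}. a (\<pi> j) * decr_rearr \<rho> j)" by (rule ennreal_leI)
        also have "\<dots> \<le> lp_norm (ennreal q) {n<..} (decr_rearr \<rho>)"
        proof (rule Holder_unit_lp_norm[OF pq a0 a])
          show "inj_on \<pi> {n<..m}" using inj by (rule inj_on_subset) auto
          show "\<pi> ` {n<..m} \<subseteq> multi_indices" using img by auto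
          show "0 \<le> decr_rearr \<rho> j" if "j \<in> {n<..}" for j
            using that d[of j] pos[of "\<pi> j"] by simp
        qed auto
        finally show ?thesis by (simp add: delta_tail_def)
      qed
      have "(\<lambda>m. ennreal (norm ((\<Sum>j=1..m. f j) - P y))) \<longlonglongrightarrow> ennreal (norm (u y - P y))"
        by (intro tendsto_ennrealI tendsto_norm lim)
      then show "ennreal (norm (u y - P y)) \<le> delta_tail \<rho> n q"
        by (rule tendsto_upperbound) (use bound in \<open>auto simp: eventually_sequentially\<close>)
    qed
  qed
qed

section \<open>The convergence rate\<close>

text \<open>Stechkin's inequality combined with the Euler product; \<open>1 + h \<le> s * q\<close>
  says that \<open>\<beta> \<le> q\<close>. The parameter \<open>h\<close> stays free because it is
  used both depending on \<open>n\<close> and at a fixed value.\<close>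

lemma delta_tail_rho_star_le:
  assumes s: "0 < s" and h: "0 < h" "1 + h \<le> s * q" and n: "1 \<le> n"
  shows "delta_tail (rho_star s) n q
    \<le> ennreal (real n powr (1 / q - s / (1 + h)) * 2 powr ((1 + 2 / h) * (s / (1 + h))))"
proof -
  have pos: "0 < mpow (rho_star s) \<nu>" for \<nu>
    using rho_star_ge[OF s] by (intro mpow_pos) (smt (verit) powr_gt_zero)
  define \<beta> where "\<beta> = (1 + h) / s"
  have \<beta>: "0 < \<beta>" "\<beta> \<le> q" using s h by (auto simp: \<beta>_def field_simps)
  have sum_le: "(\<Sum>\<nu>\<in>F. (1 / mpow (rho_star s) \<nu>) powr \<beta>) \<le> 2 powr (1 + 2 / h)"
    if "finite F" "F \<subseteq> multi_indices" for F
    unfolding \<beta>_def using s h(1) that by (rule sum_mpow_rho_star_le)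
  have fin: "finite {\<nu> \<in> multi_indices. mpow (rho_star s) \<nu> \<le> c}" for c
    using pos \<beta>(1) sum_le by (rule finite_sublevel)
  obtain \<pi> where \<pi>: "bij_betw \<pi> {1..} multi_indices"
    and d: "\<And>j. 1 \<le> j \<Longrightarrow> decr_rearr (rho_star s) j = 1 / mpow (rho_star s) (\<pi> j)"
    and mono: "\<And>i j. 1 \<le> i \<Longrightarrow> i \<le> j \<Longrightarrow> decr_rearr (rho_star s) j \<le> decr_rearr (rho_star s) i"
    using decr_rearr_enumeration[OF fin pos] by blast
  have "delta_tail (rho_star s) n q
      \<le> ennreal (real n powr (1 / q - 1 / \<beta>) * (2 powr (1 + 2 / h)) powr (1 / \<beta>))"
    unfolding delta_tail_def
  proof (rule lp_norm_tail_le[OF _ mono _ \<beta> n])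
    show "0 \<le> decr_rearr (rho_star s) j" if "1 \<le> j" for j
      using that pos[of "\<pi> j"] by (simp add: d)
    show "(\<Sum>j\<in>F. decr_rearr (rho_star s) j powr \<beta>) \<le> 2 powr (1 + 2 / h)"
      if F: "finite F" "F \<subseteq> {1..}" for F
    proof -
      have "(\<Sum>j\<in>F. decr_rearr (rho_star s) j powr \<beta>)
          = (\<Sum>j\<in>F. (1 / mpow (rho_star s) (\<pi> j)) powr \<beta>)"
        using F d by (intro sum.cong) auto
      also have "\<dots> = (\<Sum>\<nu>\<in>\<pi> ` F. (1 / mpow (rho_star s) \<nu>) powr \<beta>)"
        using inj_on_subset[OF bij_betw_imp_inj_on[OF \<pi>] F(2)] by (simp add: sum.reindex)
      also have "\<dots> \<le> 2 powr (1 + 2 / h)"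
        using F bij_betwE[OF \<pi>] by (intro sum_le) auto
      finally show ?thesis .
    qed
  qed
  then show ?thesis by (simp add: \<beta>_def powr_powr)
qed

text \<open>Compare exponents of 2, with \<open>L = log 2 n\<close>. Replacing
  \<open>s / (1 + h)\<close> by \<open>s\<close> costs at most \<open>L * s * h = s * L / R\<close>,
  hence at most \<open>s * R\<close> since \<open>R * R = 4 + L\<close>. The Euler product costs at
  most \<open>(1 + 2 * R) * s\<close>, hence at most \<open>3 * R * s\<close>. Together they give
  the factor 4.\<close>

lemma rate_exponent_le:
  fixes n :: nat and s q :: real
  assumes s: "0 < s" and n: "2 \<le> n"
  defines "R \<equiv> sqrt (4 + log 2 (real n))"
  defines "h \<equiv> 1 / R"
  shows "real n powr (1 / q - s / (1 + h)) * 2 powr ((1 + 2 / h) * (s / (1 + h)))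
    \<le> real n powr (- s + 1 / q) * real n powr (4 * s * R / log 2 (real n))"
proof -
  define L where "L = log 2 (real n)"
  have L: "0 < L" using n by (simp add: L_def)
  have "n powr x = 2 powr (L * x)" for x
    using n by (simp add: L_def flip: powr_powr)
  note np = this
  have R: "1 \<le> R" "R * R = 4 + L" using L by (auto simp: R_def L_def)
  have h: "0 < h" "2 / h = 2 * R" using R by (auto simp: h_def)
  have "s - s / (1 + h) = s * h * (1 / (1 + h))" using h by (simp add: field_simps)
  also have "\<dots> \<le> s * h * 1" using h s by (intro mult_left_mono) auto
  finally have "L * (s - s / (1 + h)) \<le> L * (s * h)" using L by (intro mult_left_mono) auto
  also have "\<dots> = s * (L / R)" by (simp add: h_def)
  also have "L / R \<le> R" using R L by (simp add: field_simps)
  finally have 1: "L * (s - s / (1 + h)) \<le> s * R" using s by simp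
  have "(1 + 2 / h) * (s / (1 + h)) \<le> (1 + 2 / h) * s"
    using h s R by (intro mult_left_mono) (auto simp: field_simps)
  also have "\<dots> \<le> (3 * R) * s" unfolding h(2) using R s by (intro mult_right_mono) auto
  finally have "L * (1 / q - s / (1 + h)) + (1 + 2 / h) * (s / (1 + h))
      \<le> L * (- s + 1 / q) + L * (4 * s * R / L)"
    using 1 L by (simp add: algebra_simps)
  then show ?thesis
    unfolding L_def[symmetric] np powr_add[symmetric] by (intro powr_mono) auto
qed

theorem corollary5p5:
  fixes p :: ennreal and q s :: real
  assumes "1 < p" and "1 / p + 1 / ennreal q = 1" and "1 / q < s"
  shows "(\<forall>n\<ge>2. approx_error n (U_ball (rho_star s) p :: ((nat \<Rightarrow> real) \<Rightarrow> 'a::banach) set)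
              \<le> delta_tail (rho_star s) n q)
       \<and> (\<exists>C::real. \<forall>n\<ge>2. delta_tail (rho_star s) n q
              \<le> ennreal (C * real n powr (- s + 1 / q)
                   * real n powr (4 * s * sqrt (4 + log 2 (real n)) / log 2 (real n))))"
proof
  have q: "0 < q" using assms(1,2) by (rule conjugate_exponent_cases) auto
  then have s: "0 < s" using assms(3) by (meson less_trans zero_less_divide_1_iff)
  have sq: "1 < s * q" using assms(3) q by (simp add: field_simps)
  have one: "1 < rho_star s j" for j
    using less_le_trans[OF gr_one_powr rho_star_ge[OF s]] s by simp
  \<comment> \<open>Any positive \<open>h\<close> makes the Euler product finite;
    \<open>h = 1\<close> is taken.\<close>
  have fin: "finite {\<nu> \<in> multi_indices. mpow (rho_star s) \<nu> \<le> c}" for c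
  proof (rule finite_sublevel)
    show "0 < mpow (rho_star s) \<nu>" for \<nu>
      using one by (intro mpow_pos) (meson less_trans zero_less_one)
    show "0 < (1 + 1) / s" using s by simp
    show "(\<Sum>\<nu>\<in>F. (1 / mpow (rho_star s) \<nu>) powr ((1 + 1) / s)) \<le> 2 powr (1 + 2 / 1)"
      if "finite F" "F \<subseteq> multi_indices" for F
      using s zero_less_one that by (rule sum_mpow_rho_star_le)
  qed
  show "\<forall>n\<ge>2. approx_error n (U_ball (rho_star s) p :: ((nat \<Rightarrow> real) \<Rightarrow> 'a::banach) set)
      \<le> delta_tail (rho_star s) n q"
    using approx_error_le_delta_tail[OF one fin assms(1,2)] by blast
  \<comment> \<open>The largest admissible \<open>h\<close>, for which \<open>\<beta> = q\<close>:
    the power of \<open>n\<close> disappears and the tail is bounded by the constant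
    \<open>D\<close>.\<close>
  define h0 where "h0 = s * q - 1"
  define D where "D = 2 powr ((1 + 2 / h0) * (s / (1 + h0)))"
  \<comment> \<open>Beyond \<open>N\<close> one has \<open>1 / h0 \<le> R\<close>, so that
    \<open>h = 1 / R\<close> is admissible.\<close>
  obtain N :: nat where N: "2 powr (1 / h0)\<^sup>2 \<le> real N" using real_arch_simple by blast
  \<comment> \<open>The value 1 suffices where \<open>h = 1 / R\<close> is admissible; the other
    entry covers the remaining \<open>n\<close>, all at most \<open>N\<close>.\<close>
  define C where "C = max 1 (D * real N powr (s - 1 / q))"
  have h0: "0 < h0" "1 / q - s / (1 + h0) = 0" using sq q s by (auto simp: h0_def)
  show "\<exists>C::real. \<forall>n\<ge>2. delta_tail (rho_star s) n q
      \<le> ennreal (C * real n powr (- s + 1 / q)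
         * real n powr (4 * s * sqrt (4 + log 2 (real n)) / log 2 (real n)))"
  proof (intro exI[of _ C] allI impI)
    fix n :: nat assume n: "2 \<le> n"
    define R where "R = sqrt (4 + log 2 (real n))"
    define M where "M = real n powr (- s + 1 / q)"
    define X where "X = real n powr (4 * s * R / log 2 (real n))"
    have L: "0 < log 2 (real n)" using n by simp
    then have R: "0 < R" by (simp add: R_def)
    have X: "1 \<le> X" unfolding X_def using n s R L by (intro ge_one_powr_ge_zero) auto
    have M: "0 < M" using n by (simp add: M_def)
    have "delta_tail (rho_star s) n q \<le> ennreal (C * M * X)"
    proof (cases "1 + 1 / R \<le> s * q")
      case True
      have "delta_tail (rho_star s) n q \<le> ennreal (M * X)"
        by (rule order_trans[OF delta_tail_rho_star_le[OF s _ True]])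
          (use R n rate_exponent_le[OF s n, of q] in \<open>auto simp: R_def M_def X_def intro!: ennreal_leI\<close>)
      also have "M * X \<le> C * (M * X)" using M X by (intro mult_right_mono[of 1 C, simplified]) (auto simp: C_def)
      finally show ?thesis by (simp add: ennreal_leI mult.assoc)
    next
      case False
      have "n \<le> N"
      proof (rule ccontr)
        assume "\<not> n \<le> N"
        then have "2 powr (1 / h0)\<^sup>2 \<le> real n" using N by simp
        then have "(1 / h0)\<^sup>2 \<le> log 2 (real n)" using n by (simp add: le_log_iff)
        then have "(1 / h0)\<^sup>2 \<le> 4 + log 2 (real n)" by simp
        then have "1 / h0 \<le> R" unfolding R_def by (rule real_le_rsqrt)
        then have "1 / R \<le> h0" using R h0 by (simp add: field_simps)
        with False show False by (simp add: h0_def)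
      qed
      \<comment> \<open>Since \<open>s > 1 / q\<close>, the ratio of \<open>D\<close> to
        \<open>M = real n powr (- s + 1 / q)\<close> grows with \<open>n\<close>, so its value at
        \<open>N\<close> bounds it for all \<open>n \<le> N\<close>.\<close>
      then have "real n powr (s - 1 / q) \<le> real N powr (s - 1 / q)"
        using assms(3) by (intro powr_mono2) auto
      then have "D * real n powr (s - 1 / q) \<le> C"
        by (auto simp: C_def D_def le_max_iff_disj)
      then have "D * real n powr (s - 1 / q) * M \<le> C * M" using M by (intro mult_right_mono) auto
      moreover have "real n powr (s - 1 / q) * M = 1"
        using n by (simp add: M_def flip: powr_add)
      ultimately have "D \<le> C * M" by (simp add: mult.assoc)
      also have "\<dots> \<le> C * M * X" using mult_left_mono[OF X, of "C * M"] M by (simp add: C_def)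
      finally have "D \<le> C * M * X" .
      moreover have "delta_tail (rho_star s) n q \<le> ennreal D"
        using delta_tail_rho_star_le[OF s h0(1), of q n] n h0 by (simp add: D_def h0_def)
      ultimately show ?thesis by (meson ennreal_leI order_trans)
    qed
    then show "delta_tail (rho_star s) n q \<le> ennreal (C * real n powr (- s + 1 / q)
        * real n powr (4 * s * sqrt (4 + log 2 (real n)) / log 2 (real n)))"
      by (simp add: M_def X_def R_def)
  qed
qed

end
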